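(* $\mathcal{S}_3(2,3)=\mathbb{N}\setminus\{1,2,3,4,5,7\}$.
   Context: Let $V$ be a set of $v$ elements and let $k,t$ be positive integers with $t<k<v$. A block is a $k$-subset of $V$. A $\mu$-way $(v,k,t)$ trade of volume $m$ is a family $T=\{T_1,\dots,T_\mu\}$ of $\mu$ pairwise disjoint collections of blocks, each $T_i$ consisting of exactly $m$ blocks, such that for every $t$-subset $S$ of $V$, the number of blocks of $T_i$ containing $S$ is the same for all $i$. $\mathcal{S}_\mu(t,k)$ denotes the set of all positive integers $m$ such that a $\mu$-way $(v,k,t)$ trade of volume $m$ exists for some $v$. Here $\mathbb{N}=\{1,2,3,\dots\}$. *)

theory Defs
  imports Main
begin

definition blocks :: "'a set \<Rightarrow> nat \<Rightarrow> 'a set set" where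
  "blocks V k = {B. B \<subseteq> V \<and> card B = k}"

text \<open>
  A collection of blocks is a set of blocks (no repeated blocks); the \<open>\<mu>\<close> collections
  are \<open>T 0, \<dots>, T (\<mu> - 1)\<close>, and the values \<open>T i\<close> with \<open>i \<ge> \<mu>\<close> are irrelevant.
\<close>

definition way_trade ::
  "nat \<Rightarrow> 'a set \<Rightarrow> nat \<Rightarrow> nat \<Rightarrow> nat \<Rightarrow> (nat \<Rightarrow> 'a set set) \<Rightarrow> bool" where
  "way_trade \<mu> V k t m T \<longleftrightarrow>
     finite V \<and> 0 < t \<and> t < k \<and> k < card V \<and>
     (\<forall>i<\<mu>. T i \<subseteq> blocks V k \<and> card (T i) = m) \<and>
     (\<forall>i<\<mu>. \<forall>j<\<mu>. i \<noteq> j \<longrightarrow> T i \<inter> T j = {}) \<and>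
     (\<forall>S \<in> blocks V t. \<forall>i<\<mu>. \<forall>j<\<mu>.
        card {B \<in> T i. S \<subseteq> B} = card {B \<in> T j. S \<subseteq> B})"

text \<open>
  The existence of a trade depends only on the number \<open>v\<close> of points, so the point set is
  taken to be \<open>{..<v}\<close>.
\<close>

definition trade_volumes :: "nat \<Rightarrow> nat \<Rightarrow> nat \<Rightarrow> nat set" where
  "trade_volumes \<mu> t k = {m. 0 < m \<and> (\<exists>(v::nat) T. way_trade \<mu> {..<v} k t m T)}"

end

theory Submission
  imports Defs
begin

text \<open>
  Volumes add under disjoint union, so explicit trades of volumes 6, 8, 9, 10, 11 and 13 suffice
  for existence.

  Conversely, let the degree of a point be the number of blocks of one collection through it, and
  the weight of a pair the number of blocks containing it; neither depends on the collection. The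
  three collections put disjoint sets of third points on a pair, so a point on a pair of weight
  \<open>w > 0\<close> has more than \<open>3w\<close> neighbours; hence every degree is at least 2. For volume at most 7,
  counting degrees (their sum is three times the volume) shows that points of degree 2 are pairwise
  non-adjacent and then that all weights are at most 1. A block through \<open>x\<close> in one collection
  determines a block avoiding \<open>x\<close> in another, so the volume is at least twice any degree. Since
  degree 3 occurs, the volume is 6 or 7. In volume 7 all degrees are 2 or 3; a point of degree 2
  contradicts counting non-adjacent pairs, and if all degrees are 3 the collections are three
  disjoint Fano planes on the same 7 points, which do not exist.
\<close>

subsection \<open>Constructing trades\<close>

text \<open>The second trade is shifted by \<open>v\<close>, so that its points are disjoint from
  those of the first; the numbers of blocks through a set then add.\<close>

lemma trade_volumes_add:
  assumes "m \<in> trade_volumes \<mu> t k" "n \<in> trade_volumes \<mu> t k"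
  shows "m + n \<in> trade_volumes \<mu> t k"
proof -
  obtain v T w U where m: "0 < m" and T: "way_trade \<mu> {..<v::nat} k t m T"
    and U: "way_trade \<mu> {..<w::nat} k t n U"
    using assms unfolding trade_volumes_def by blast
  define s where "s = (\<lambda>x::nat. x + v)"
  have inj: "inj s" by (simp add: s_def inj_def)
  define W where "W i = T i \<union> (`) s ` U i" for i
  have t: "0 < t" "t < k" and kv: "k < v" and kw: "k < w"
    using T U by (auto simp: way_trade_def)
  have Tv: "B \<subseteq> {..<v}" "card B = k" if "i < \<mu>" "B \<in> T i" for i B
    using T that unfolding way_trade_def blocks_def by blast+
  have Uw: "B \<subseteq> {..<w}" "card B = k" if "i < \<mu>" "B \<in> U i" for i B
    using U that unfolding way_trade_def blocks_def by blast+
  have finT: "finite (T i)" if "i < \<mu>" for i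
    by (rule finite_subset[of _ "Pow {..<v}"]) (use Tv that in auto)
  have finU: "finite (U i)" if "i < \<mu>" for i
    by (rule finite_subset[of _ "Pow {..<w}"]) (use Uw that in auto)
  have injs: "inj_on ((`) s) X" for X
    using inj by (auto simp: inj_on_def inj_image_eq_iff)
  \<comment> \<open>A shifted block is nonempty and all its points are at least \<open>v\<close>, so
    it is no block of the first trade.\<close>
  have sep: "B \<noteq> s ` B'" if "i < \<mu>" "j < \<mu>" "B \<in> T i" "B' \<in> U j" for i j B B'
  proof
    assume "B = s ` B'"
    moreover have "B' \<noteq> {}" using Uw(2)[OF that(2,4)] t by auto
    ultimately show False using Tv(1)[OF that(1,3)] by (auto simp: s_def)
  qed
  have cardW: "card (W i) = m + n" if "i < \<mu>" for i
  proof -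
    have "card (W i) = card (T i) + card ((`) s ` U i)"
      unfolding W_def by (rule card_Un_disjoint) (use sep finT finU that in auto)
    then show ?thesis using T U that by (simp add: card_image injs way_trade_def)
  qed
  have blocksW: "W i \<subseteq> blocks {..<v + w} k" if "i < \<mu>" for i
  proof
    fix B assume "B \<in> W i"
    then consider "B \<in> T i" | B' where "B' \<in> U i" "B = s ` B'" by (auto simp: W_def)
    then show "B \<in> blocks {..<v + w} k"
    proof cases
      case 1
      then show ?thesis using Tv[OF that 1] by (auto simp: blocks_def)
    next
      case 2
      have "card B = k" using Uw(2)[OF that 2(1)] 2(2) inj by (simp add: card_image inj_on_subset)
      moreover have "B \<subseteq> {..<v + w}" using Uw(1)[OF that 2(1)] 2(2) by (auto simp: s_def)
      ultimately show ?thesis by (simp add: blocks_def)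
    qed
  qed
  have disjW: "W i \<inter> W j = {}" if "i < \<mu>" "j < \<mu>" "i \<noteq> j" for i j
  proof -
    have "T i \<inter> T j = {}" "U i \<inter> U j = {}" using T U that by (auto simp: way_trade_def)
    then show ?thesis
      using sep[OF that(1,2)] sep[OF that(2,1)] inj unfolding W_def
      by (auto simp: inj_image_eq_iff; metis)
  qed
  have countW: "card {B \<in> W i. S \<subseteq> B} = card {B \<in> T i. S \<subseteq> B} + card {B \<in> U i. S \<subseteq> s ` B}"
    if "i < \<mu>" for i S
  proof -
    have "{B \<in> W i. S \<subseteq> B} = {B \<in> T i. S \<subseteq> B} \<union> (`) s ` {B \<in> U i. S \<subseteq> s ` B}"
      by (auto simp: W_def)
    moreover have "card \<dots> = card {B \<in> T i. S \<subseteq> B} + card ((`) s ` {B \<in> U i. S \<subseteq> s ` B})"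
      by (rule card_Un_disjoint) (use sep finT finU that in auto)
    ultimately show ?thesis by (simp add: card_image injs)
  qed
  \<comment> \<open>A set of size \<open>t\<close> that is not contained in the point set of the
    first trade lies in none of its blocks: both counts are 0. The same split serves the shifted
    trade.\<close>
  have cT: "card {B \<in> T i. S \<subseteq> B} = card {B \<in> T j. S \<subseteq> B}"
    if "i < \<mu>" "j < \<mu>" "card S = t" for i j S
  proof (cases "S \<subseteq> {..<v}")
    case True
    then show ?thesis using T that unfolding way_trade_def blocks_def by blast
  next
    case False
    then have "{B \<in> T i. S \<subseteq> B} = {}" "{B \<in> T j. S \<subseteq> B} = {}" using Tv that by blast+
    then show ?thesis by metis
  qed
  have cU: "card {B \<in> U i. S \<subseteq> s ` B} = card {B \<in> U j. S \<subseteq> s ` B}"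
    if "i < \<mu>" "j < \<mu>" "card S = t" for i j S
  proof (cases "\<exists>S' \<subseteq> {..<w}. S = s ` S'")
    case True
    then obtain S' where S': "S' \<subseteq> {..<w}" "S = s ` S'" by blast
    then have "card S' = t" using that inj by (simp add: card_image inj_on_subset)
    then have "card {B \<in> U i. S' \<subseteq> B} = card {B \<in> U j. S' \<subseteq> B}"
      using U that S' unfolding way_trade_def blocks_def by blast
    then show ?thesis using inj S' by (simp add: inj_image_subset_iff)
  next
    case False
    then have "\<not> S \<subseteq> s ` B" if "B \<subseteq> {..<w}" for B
      using that by (meson subset_imageE subset_trans)
    then have "{B \<in> U i. S \<subseteq> s ` B} = {}" "{B \<in> U j. S \<subseteq> s ` B} = {}" using Uw that by blast+
    then show ?thesis by metis
  qed
  have "way_trade \<mu> {..<v + w} k t (m + n) W"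
    unfolding way_trade_def
  proof (intro conjI ballI allI impI)
    fix S i j assume S: "S \<in> blocks {..<v + w} t" and ij: "i < \<mu>" "j < \<mu>"
    then have "card S = t" by (simp add: blocks_def)
    then show "card {B \<in> W i. S \<subseteq> B} = card {B \<in> W j. S \<subseteq> B}"
      using countW[OF ij(1), of S] countW[OF ij(2), of S] cT[OF ij] cU[OF ij] by presburger
  qed (use t kv cardW blocksW disjW in simp_all)
  then show ?thesis using m unfolding trade_volumes_def by blast
qed

section \<open>Certificates for explicit trades\<close>

definition triple_set :: "nat \<times> nat \<times> nat \<Rightarrow> nat set" where
  "triple_set = (\<lambda>(a, b, c). {a, b, c})"

fun pair_in :: "nat \<Rightarrow> nat \<Rightarrow> nat \<times> nat \<times> nat \<Rightarrow> bool" where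
  "pair_in x y (a, b, c) \<longleftrightarrow> (x = a \<or> x = b \<or> x = c) \<and> (y = a \<or> y = b \<or> y = c)"

text \<open>Increasing order gives each 3-set a single triple, so equality of blocks can be tested
  on triples.\<close>

fun sorted_below :: "nat \<Rightarrow> nat \<times> nat \<times> nat \<Rightarrow> bool" where
  "sorted_below v (a, b, c) \<longleftrightarrow> a < b \<and> b < c \<and> c < v"

definition pair_count :: "nat \<Rightarrow> nat \<Rightarrow> (nat \<times> nat \<times> nat) list \<Rightarrow> nat" where
  "pair_count x y L = length (filter (pair_in x y) L)"

text \<open>An executable certificate. Distinctness of the concatenation says both that no block is
  repeated and that the collections are disjoint. As \<open>pair_in\<close> is symmetric in its two
  points, testing pairs with \<open>y < x\<close> is enough.\<close>

definition is_listed_trade ::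
  "nat \<Rightarrow> (nat \<times> nat \<times> nat) list \<Rightarrow> (nat \<times> nat \<times> nat) list \<Rightarrow> (nat \<times> nat \<times> nat) list \<Rightarrow> bool"
  where "is_listed_trade v K L M \<longleftrightarrow>
    3 < v \<and> K \<noteq> [] \<and> length L = length K \<and> length M = length K \<and>
    list_all (sorted_below v) (K @ L @ M) \<and> distinct (K @ L @ M) \<and>
    list_all (\<lambda>x. list_all (\<lambda>y. pair_count x y L = pair_count x y K \<and>
      pair_count x y M = pair_count x y K) [0..<x]) [0..<v]"

lemma triple_set_eq_iff:
  assumes "sorted_below v p" "sorted_below v q"
  shows "triple_set p = triple_set q \<longleftrightarrow> p = q"
proof -
  obtain a b c a' b' c' where [simp]: "p = (a, b, c)" "q = (a', b', c')"
    by (metis prod_cases3)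
  have lt: "a < b" "b < c" "a' < b'" "b' < c'" using assms by auto
  have "p = q" if "{a, b, c} = {a', b', c'}"
  proof -
    \<comment> \<open>The outer entries are the minimum and maximum of the set; the middle one is
      what remains.\<close>
    have "a = Min {a, b, c}" "a' = Min {a', b', c'}" "c = Max {a, b, c}" "c' = Max {a', b', c'}"
      using lt by (simp_all add: min_def max_def)
    then have "a = a'" "c = c'" using that by metis+
    moreover then have "b = b'" using that lt by auto
    ultimately show ?thesis by simp
  qed
  then show ?thesis by (auto simp: triple_set_def)
qed

lemma listed_trade:
  assumes "is_listed_trade v K L M"
  shows "length K \<in> trade_volumes 3 2 3"
proof -
  define F where "F i = (if i = 0 then K else if i = 1 then L else M)" for i :: nat
  define T where "T i = triple_set ` set (F i)" for i
  have Fin: "set (F i) \<subseteq> set (K @ L @ M)" for i by (auto simp: F_def)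
  have sb: "sorted_below v p" if "p \<in> set (F i)" for p i
    using assms that Fin by (auto simp: is_listed_trade_def list_all_iff)
  have dF: "distinct (F i)" for i using assms by (auto simp: is_listed_trade_def F_def)
  have lF: "length (F i) = length K" for i using assms by (auto simp: is_listed_trade_def F_def)
  have inj: "inj_on triple_set (set (F i))" for i
    by (meson inj_onI sb triple_set_eq_iff)
  have card: "card {B \<in> T i. P B} = length (filter (P \<circ> triple_set) (F i))" for i P
  proof -
    have "{B \<in> T i. P B} = triple_set ` set (filter (P \<circ> triple_set) (F i))"
      by (auto simp: T_def)
    moreover have "inj_on triple_set (set (filter (P \<circ> triple_set) (F i)))"
      using inj[of i] by (rule inj_on_subset) auto
    ultimately have "card {B \<in> T i. P B} = card (set (filter (P \<circ> triple_set) (F i)))"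
      by (simp add: card_image)
    then show ?thesis
      using distinct_card[OF distinct_filter[OF dF]] by metis
  qed
  have blk: "T i \<subseteq> blocks {..<v} 3" for i
    using sb[of _ i] by (fastforce simp: T_def blocks_def triple_set_def)
  have disj: "T i \<inter> T j = {}" if "i < 3" "j < 3" "i \<noteq> j" for i j
  proof -
    have "set (F i) \<inter> set (F j) = {}"
      using assms that by (auto simp: F_def is_listed_trade_def)
    then show ?thesis
      using sb[of _ i] sb[of _ j] triple_set_eq_iff[of v]
      unfolding T_def disjoint_iff image_iff by metis
  qed
  have cnt: "card {B \<in> T i. S \<subseteq> B} = pair_count x y (F i)" if "S = {x, y}" for i S x y
    unfolding card pair_count_def that
    by (rule arg_cong[of _ _ length], rule filter_cong) (auto simp: triple_set_def)
  have cnt_eq: "pair_count x y (F i) = pair_count x y (F j)" if "y < x" "x < v" for i j x y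
  proof -
    have "pair_count x y L = pair_count x y K \<and> pair_count x y M = pair_count x y K"
      using assms that by (simp add: is_listed_trade_def list_all_iff)
    then show ?thesis by (simp add: F_def)
  qed
  have ex_pair: "\<exists>x y. S = {x, y} \<and> y < x \<and> x < v" if S: "S \<in> blocks {..<v} 2" for S
  proof -
    obtain x y where "S = {x, y}" "x \<noteq> y"
      using S unfolding blocks_def card_2_iff by blast
    moreover from this have "x < v" "y < v" using S by (auto simp: blocks_def)
    ultimately show ?thesis by (metis insert_commute nat_neq_iff)
  qed
  have cardT: "card (T i) = length K" for i
    unfolding T_def using inj dF lF by (simp add: card_image distinct_card)
  have "way_trade 3 {..<v} 3 2 (length K) T"
    unfolding way_trade_def
  proof (intro conjI ballI allI impI)
    fix S i j assume S: "S \<in> blocks {..<v} 2"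
    then obtain x y where "S = {x, y}" "y < x" "x < v" using ex_pair by blast
    then show "card {B \<in> T i. S \<subseteq> B} = card {B \<in> T j. S \<subseteq> B}"
      using cnt[of S x y] cnt_eq[of y x] by metis
  qed (use assms blk disj cardT in \<open>simp_all add: is_listed_trade_def\<close>)
  then show ?thesis using assms unfolding trade_volumes_def is_listed_trade_def by blast
qed

subsection \<open>Fano planes\<close>

text \<open>A Steiner triple system of order 7 on the points 0 to 6. Only triples of such points are
  tested, so \<open>X\<close> may contain other sets. Bounded quantifiers and the order
  \<open>k < l\<close> let the formula expand to a small propositional one.\<close>

definition fano_plane :: "nat set set \<Rightarrow> bool" where
  "fano_plane X \<longleftrightarrow> (\<forall>j<7. \<forall>i<j.
     (\<exists>k<7. k \<noteq> i \<and> k \<noteq> j \<and> {i, j, k} \<in> X) \<and>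
     (\<forall>l<7. \<forall>k<l. k \<noteq> i \<longrightarrow> k \<noteq> j \<longrightarrow> l \<noteq> i \<longrightarrow> l \<noteq> j \<longrightarrow> {i, j, k} \<in> X \<longrightarrow> {i, j, l} \<notin> X))"

text \<open>
  Expanding all quantifiers leaves a propositional problem about the \<open>28\<close> triples that are not
  lines of the standard plane.
\<close>

lemma no_three_disjoint_fano_planes:
  assumes "fano_plane X" "fano_plane Y" "X \<inter> Y = {}"
    and "X \<inter> A = {}" "Y \<inter> A = {}"
    and "{{0, 1, 2}, {0, 3, 4}, {0, 5, 6}, {1, 3, 5}, {1, 4, 6}, {2, 3, 6}, {2, 4, 5}} \<subseteq> A"
  shows False
proof -
  have A: "{0, 1, 2} \<notin> Z" "{0, 3, 4} \<notin> Z" "{0, 5, 6} \<notin> Z" "{1, 3, 5} \<notin> Z"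
    "{1, 4, 6} \<notin> Z" "{2, 3, 6} \<notin> Z" "{2, 4, 5} \<notin> Z" if "Z \<in> {X, Y}" for Z
    using assms that by auto
  \<comment> \<open>Restricted to increasing triples, disjointness expands to 35 clauses.\<close>
  have XY: "\<forall>k<7. \<forall>j<k. \<forall>i<j. \<not> ({i, j, k} \<in> X \<and> {i, j, k} \<in> Y)"
    using assms(3) by blast
  show False
    using assms(1,2) XY A[of X] A[of Y] unfolding fano_plane_def
    by (simp (no_asm_use) add: eval_nat_numeral All_less_Suc Ex_less_Suc insert_commute) sat
qed

subsection \<open>Small volumes\<close>

locale triple_trade =
  fixes V :: "'a set" and T :: "nat \<Rightarrow> 'a set set" and m :: nat
  assumes trade: "way_trade 3 V 3 2 m T"
begin

section \<open>Degrees, weights, neighbours and third points\<close>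

definition deg :: "'a \<Rightarrow> nat" where
  "deg x = card {B \<in> T 0. x \<in> B}"

definition wt :: "'a \<Rightarrow> 'a \<Rightarrow> nat" where
  "wt x y = card {B \<in> T 0. {x, y} \<subseteq> B}"

definition nb :: "'a \<Rightarrow> 'a set" where
  "nb x = {y \<in> V. y \<noteq> x \<and> 0 < wt x y}"

definition thirds :: "nat \<Rightarrow> 'a \<Rightarrow> 'a \<Rightarrow> 'a set" where
  "thirds i x y = {z. z \<noteq> x \<and> z \<noteq> y \<and> {x, y, z} \<in> T i}"

definition supp :: "'a set" where
  "supp = {x \<in> V. 0 < deg x}"

lemma finite_V [simp]: "finite V"
  using trade by (simp add: way_trade_def)

lemma block: "B \<subseteq> V" "card B = 3" if "B \<in> T i" "i < 3"
  using trade that unfolding way_trade_def blocks_def by blast+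

lemma card_T: "i < 3 \<Longrightarrow> card (T i) = m"
  using trade unfolding way_trade_def by blast

lemma disjoint_T: "B \<in> T i \<Longrightarrow> B \<in> T j \<Longrightarrow> i < 3 \<Longrightarrow> j < 3 \<Longrightarrow> i = j"
  using trade unfolding way_trade_def by blast

lemma finite_T: "i < 3 \<Longrightarrow> finite (T i)"
  by (rule finite_subset[of _ "Pow V"]) (use block in auto)

text \<open>The trade condition covers pairs inside \<open>V\<close>; any other pair lies in no
  block, so both counts are 0.\<close>

lemma wt_eq:
  assumes "x \<noteq> y" "i < 3"
  shows "card {B \<in> T i. {x, y} \<subseteq> B} = wt x y"
proof (cases "{x, y} \<subseteq> V")
  case True
  then have "{x, y} \<in> blocks V 2" using assms by (simp add: blocks_def)
  then show ?thesis using trade assms unfolding way_trade_def wt_def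
    by (meson zero_less_numeral)
next
  case False
  have "{B \<in> T j. {x, y} \<subseteq> B} = {}" if "j < 3" for j
    using False block(1)[OF _ that] by blast
  then show ?thesis using assms unfolding wt_def by (metis zero_less_numeral)
qed

lemma wt_commute: "wt x y = wt y x"
  by (simp add: wt_def insert_commute)

lemma nb_commute: "y \<in> nb x \<Longrightarrow> x \<in> V \<Longrightarrow> x \<in> nb y"
  by (auto simp: nb_def wt_commute)

lemma finite_nb [simp]: "finite (nb x)"
  by (simp add: nb_def)

lemma not_in_nb [simp]: "x \<notin> nb x"
  by (simp add: nb_def)

lemma thirds_commute: "thirds i x y = thirds i y x"
  by (auto simp: thirds_def insert_commute)

lemma thirds_rotate: "z \<in> thirds i x y \<Longrightarrow> x \<noteq> y \<Longrightarrow> y \<in> thirds i x z"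
  by (auto simp: thirds_def insert_commute)

text \<open>A block through a pair is determined by its third point. Weights thus become sizes of
  point sets, to which disjointness of the collections applies.\<close>

lemma card_thirds:
  assumes "x \<noteq> y" "i < 3"
  shows "card (thirds i x y) = wt x y"
proof -
  have "bij_betw (\<lambda>z. {x, y, z}) (thirds i x y) {B \<in> T i. {x, y} \<subseteq> B}"
  proof (rule bij_betwI')
    fix z w assume "z \<in> thirds i x y" "w \<in> thirds i x y"
    then show "({x, y, z} = {x, y, w}) = (z = w)" by (auto simp: thirds_def)
  next
    fix z assume "z \<in> thirds i x y"
    then show "{x, y, z} \<in> {B \<in> T i. {x, y} \<subseteq> B}" by (auto simp: thirds_def)
  next
    fix B assume B: "B \<in> {B \<in> T i. {x, y} \<subseteq> B}"
    then have "card B = 3" "{x, y} \<subseteq> B" using block(2) assms by auto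
    then have "card (B - {x, y}) = 1" using assms by (simp add: card_Diff_subset)
    then obtain z where "B - {x, y} = {z}" by (auto simp: card_1_singleton_iff)
    then have "B = {x, y, z}" "z \<noteq> x" "z \<noteq> y" using B by auto
    then show "\<exists>z \<in> thirds i x y. B = {x, y, z}" using B by (auto simp: thirds_def)
  qed
  then show ?thesis using wt_eq[OF assms] by (simp add: bij_betw_same_card)
qed

lemma finite_thirds [simp]: "i < 3 \<Longrightarrow> finite (thirds i x y)"
  by (rule finite_subset[of _ V]) (use block(1) in \<open>auto simp: thirds_def\<close>)

lemma thirds_disjoint: "i < 3 \<Longrightarrow> j < 3 \<Longrightarrow> i \<noteq> j \<Longrightarrow> thirds i x y \<inter> thirds j x y = {}"
  using disjoint_T by (auto simp: thirds_def)

lemma thirds_nb: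
  assumes "z \<in> thirds i x y" "x \<noteq> y" "i < 3"
  shows "z \<in> nb x" "z \<in> nb y" "y \<in> nb x" "x \<in> nb y"
proof -
  have pos: "0 < wt u w" if "u \<noteq> w" "v \<in> thirds i u w" for u v w
    by (subst card_thirds[OF that(1) assms(3), symmetric])
      (use that(2) assms(3) in \<open>auto simp: card_gt_0_iff\<close>)
  have *: "z \<noteq> x" "z \<noteq> y" "{x, y, z} \<in> T i" using assms by (auto simp: thirds_def)
  then have "x \<in> V" "y \<in> V" "z \<in> V" using block(1) assms by blast+
  moreover have "0 < wt x z" "0 < wt y z" "0 < wt x y"
    using pos[of x y z] pos[of x z y] pos[of y z x] * assms
    by (auto simp: thirds_def insert_commute)
  ultimately show "z \<in> nb x" "z \<in> nb y" "y \<in> nb x" "x \<in> nb y"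
    using * assms by (auto simp: nb_def wt_commute)
qed

lemma card_Union_thirds:
  assumes "x \<noteq> y"
  shows "card (\<Union>i<3. thirds i x y) = 3 * wt x y"
proof -
  have "card (\<Union>i<3. thirds i x y) = (\<Sum>i<3. card (thirds i x y))"
    by (rule card_UN_disjoint) (use thirds_disjoint in auto)
  then show ?thesis using assms by (simp add: card_thirds)
qed

text \<open>The three sets of third points are disjoint, each of size \<open>wt x y\<close>, and
  they lie among the neighbours of \<open>x\<close> other than \<open>y\<close>.\<close>

lemma wt_less_card_nb:
  assumes "y \<in> nb x"
  shows "3 * wt x y < card (nb x)"
proof -
  have "x \<noteq> y" using assms by auto
  then have "(\<Union>i<3. thirds i x y) \<subseteq> nb x - {y}"
    using thirds_nb by (auto simp: thirds_def)
  then have "3 * wt x y \<le> card (nb x - {y})"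
    using card_mono[of "nb x - {y}" "\<Union>i<3. thirds i x y"] card_Union_thirds[OF \<open>x \<noteq> y\<close>]
    by simp
  also have "\<dots> < card (nb x)" using assms by (intro psubset_card_mono) auto
  finally show ?thesis .
qed

section \<open>Double counting of degrees and weights\<close>

lemma sum_wt:
  assumes "x \<in> V" "i < 3"
  shows "2 * card {B \<in> T i. x \<in> B} = (\<Sum>y\<in>nb x. wt x y)"
proof -
  let ?D = "{B \<in> T i. x \<in> B}"
  have fD: "finite ?D" using finite_T assms by simp
  have "(\<Sum>y\<in>nb x. wt x y) = (\<Sum>y\<in>V - {x}. wt x y)"
    by (rule sum.mono_neutral_left) (auto simp: nb_def)
  also have "\<dots> = (\<Sum>y\<in>V - {x}. card {B \<in> ?D. y \<in> B})"
  proof (rule sum.cong)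
    fix y assume "y \<in> V - {x}"
    then have "wt x y = card {B \<in> T i. {x, y} \<subseteq> B}" using assms wt_eq[of x y i] by auto
    also have "{B \<in> T i. {x, y} \<subseteq> B} = {B \<in> ?D. y \<in> B}" by auto
    finally show "wt x y = card {B \<in> ?D. y \<in> B}" .
  qed simp
  \<comment> \<open>Each block \<open>B\<close> through \<open>x\<close> is counted once for each of
    its two other points.\<close>
  also have "\<dots> = (\<Sum>B\<in>?D. 2)"
  proof (rule sum_multicount_gen)
    show "\<forall>B\<in>?D. card {y \<in> V - {x}. y \<in> B} = 2"
    proof
      fix B assume "B \<in> ?D"
      then have "{y \<in> V - {x}. y \<in> B} = B - {x}" "card B = 3" "x \<in> B"
        using block[of B i] assms by auto
      then show "card {y \<in> V - {x}. y \<in> B} = 2" by simp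
    qed
  qed (use fD in auto)
  finally show ?thesis by simp
qed

text \<open>The sum of weights does not refer to a collection, so the degree is the same in all
  three.\<close>

lemma deg_eq: "x \<in> V \<Longrightarrow> i < 3 \<Longrightarrow> card {B \<in> T i. x \<in> B} = deg x"
  using sum_wt[of x i] sum_wt[of x 0] by (simp add: deg_def)

lemma sum_wt_deg: "x \<in> V \<Longrightarrow> (\<Sum>y\<in>nb x. wt x y) = 2 * deg x"
  using sum_wt[of x 0] by (simp add: deg_def)

lemma finite_supp [simp]: "finite supp"
  by (simp add: supp_def)

lemma supp_V: "x \<in> supp \<Longrightarrow> x \<in> V"
  by (simp add: supp_def)

lemma sum_deg: "(\<Sum>x\<in>supp. deg x) = 3 * m"
proof -
  have "(\<Sum>x\<in>supp. deg x) = (\<Sum>x\<in>V. deg x)"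
    by (rule sum.mono_neutral_left) (auto simp: supp_def)
  also have "\<dots> = (\<Sum>B\<in>T 0. 3)"
    unfolding deg_def
  proof (rule sum_multicount_gen)
    show "\<forall>B\<in>T 0. card {x \<in> V. x \<in> B} = 3"
    proof
      fix B assume "B \<in> T 0"
      then have "{x \<in> V. x \<in> B} = B" "card B = 3" using block[of B 0] by auto
      then show "card {x \<in> V. x \<in> B} = 3" by simp
    qed
  qed (simp_all add: finite_T)
  finally show ?thesis by (simp add: card_T)
qed

lemma nb_supp:
  assumes "y \<in> nb x"
  shows "y \<in> supp"
proof -
  have "{B \<in> T 0. {x, y} \<subseteq> B} \<noteq> {}" "y \<in> V"
    using assms by (auto simp: nb_def wt_def card_gt_0_iff)
  then have "{B \<in> T 0. y \<in> B} \<noteq> {}" by blast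
  then have "0 < deg y" unfolding deg_def using finite_T[of 0] by (auto simp: card_gt_0_iff)
  then show ?thesis using \<open>y \<in> V\<close> by (simp add: supp_def)
qed

text \<open>In the sum of the weights at \<open>x\<close>, which is \<open>2 * deg x\<close>, every
  neighbour contributes at least 1 and every point of \<open>H\<close> at least one more.\<close>

lemma deg_heavy:
  assumes "x \<in> V" "H \<subseteq> nb x" "\<And>y. y \<in> H \<Longrightarrow> 2 \<le> wt x y"
  shows "card (nb x) + card H \<le> 2 * deg x"
proof -
  have fH: "finite H" using assms(2) finite_subset finite_nb by blast
  have "(\<Sum>y\<in>nb x - H. 1) \<le> (\<Sum>y\<in>nb x - H. wt x y)"
    by (rule sum_mono) (auto simp: nb_def)
  moreover have "(\<Sum>y\<in>H. 2) \<le> (\<Sum>y\<in>H. wt x y)"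
    by (rule sum_mono) (use assms(3) in auto)
  moreover have "(\<Sum>y\<in>nb x. wt x y) = (\<Sum>y\<in>nb x - H. wt x y) + (\<Sum>y\<in>H. wt x y)"
    by (rule sum.subset_diff) (use assms(2) in auto)
  moreover have "card (nb x - H) = card (nb x) - card H" "card H \<le> card (nb x)"
    using assms(2) fH by (simp_all add: card_Diff_subset card_mono)
  ultimately show ?thesis using sum_wt_deg[OF assms(1)] by simp
qed

lemma card_nb_le: "x \<in> V \<Longrightarrow> card (nb x) \<le> 2 * deg x"
  using deg_heavy[of x "{}"] by simp

lemma nb_nonempty:
  assumes "x \<in> supp"
  shows "nb x \<noteq> {}"
  using assms sum_wt_deg[of x] by (auto simp: supp_def)

lemma card_nb_ge:
  assumes "x \<in> supp"
  shows "4 \<le> card (nb x)"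
proof -
  obtain y where "y \<in> nb x" using nb_nonempty[OF assms] by auto
  then show ?thesis using wt_less_card_nb[of y x] by (auto simp: nb_def)
qed

text \<open>A point of the support has at least 4 neighbours, whereas degree 1 allows only
  2.\<close>

lemma deg_ge_2: "x \<in> supp \<Longrightarrow> 2 \<le> deg x"
  using card_nb_ge[of x] card_nb_le[of x] supp_V by fastforce

text \<open>Weight at least 2 forces at least seven neighbours, but degree at most 3 allows only
  six.\<close>

lemma wt_le_1:
  assumes "x \<in> V" "deg x \<le> 3" "y \<in> nb x"
  shows "wt x y = 1"
proof -
  have "3 * wt x y < 6 + 1" using wt_less_card_nb[OF assms(3)] card_nb_le[OF assms(1)] assms(2) by simp
  moreover have "wt x y \<noteq> 2"
  proof
    assume "wt x y = 2"
    then have "7 + 1 \<le> 2 * deg x"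
      using deg_heavy[of x "{y}"] assms wt_less_card_nb[OF assms(3)] by simp
    then show False using assms(2) by simp
  qed
  moreover have "0 < wt x y" using assms by (simp add: nb_def)
  ultimately show ?thesis by simp
qed

lemma card_nb_eq: "x \<in> V \<Longrightarrow> (\<And>y. y \<in> nb x \<Longrightarrow> wt x y = 1) \<Longrightarrow> card (nb x) = 2 * deg x"
  using sum_wt_deg[of x] by simp

section \<open>Points of degree 2\<close>

lemma deg2_clique:
  assumes "x \<in> V" "deg x = 2" "y \<in> nb x" "z \<in> nb x" "y \<noteq> z"
  shows "\<exists>i<3. z \<in> thirds i x y"
proof -
  have [simp]: "x \<noteq> y" using assms by auto
  have w: "wt x u = 1" if "u \<in> nb x" for u using wt_le_1[OF assms(1) _ that] assms(2) by simp
  have c4: "card (nb x) = 4" using card_nb_eq[OF assms(1) w] assms(2) by simp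
  \<comment> \<open>The three disjoint singletons of third points fill the three remaining
    neighbours; hence the neighbours of \<open>x\<close> are pairwise adjacent.\<close>
  have "(\<Union>i<3. thirds i x y) = nb x - {y}"
  proof (rule card_subset_eq)
    show "(\<Union>i<3. thirds i x y) \<subseteq> nb x - {y}"
      using thirds_nb by (auto simp: thirds_def)
    show "card (\<Union>i<3. thirds i x y) = card (nb x - {y})"
      using card_Union_thirds[of x y] c4 w[OF assms(3)] assms(3) by simp
  qed simp
  then show ?thesis using assms by blast
qed

lemma thirds_unique:
  assumes "wt x y = 1" "x \<noteq> y" "i < 3" "z \<in> thirds i x y" "w \<in> thirds i x y"
  shows "z = w"
  using card_thirds[OF assms(2,3)] assms(1,4,5) by (metis card_1_singletonE singletonD)

text \<open>At a point of degree 2 each collection induces a perfect matching of the four neighbours.\<close>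

lemma deg2_opposite:
  assumes "x \<in> V" "deg x = 2" "nb x = {y, z, a, b}" "distinct [y, z, a, b]"
    and "i < 3" "z \<in> thirds i x y"
  shows "b \<in> thirds i x a"
proof -
  have ne: "x \<noteq> y" "x \<noteq> z" "x \<noteq> a" "x \<noteq> b" using assms(3) not_in_nb[of x] by auto
  have w: "wt x u = 1" if "u \<in> nb x" for u using wt_le_1[OF assms(1) _ that] assms(2) by simp
  have "card (thirds i x a) = 1" using card_thirds[of x a i] ne assms w[of a] by simp
  then obtain u where u: "u \<in> thirds i x a" by (auto simp: card_1_singleton_iff)
  then have "u \<in> nb x" "u \<noteq> a" using thirds_nb(1) ne assms by (auto simp: thirds_def)
  \<comment> \<open>If \<open>u\<close> were \<open>y\<close> or \<open>z\<close>, a pair of weight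
    1 would have two third points in collection \<open>i\<close>.\<close>
  moreover have "u \<noteq> y"
  proof
    assume "u = y"
    then have "a \<in> thirds i x y" using thirds_rotate[OF u] ne by simp
    then have "a = z" using thirds_unique[of x y i a z] w[of y] ne assms by simp
    then show False using assms(4) by simp
  qed
  moreover have "u \<noteq> z"
  proof
    assume "u = z"
    then have "a \<in> thirds i x z" using thirds_rotate[OF u] ne by simp
    moreover have "y \<in> thirds i x z" using thirds_rotate[OF assms(6)] ne by simp
    ultimately have "a = y" using thirds_unique[of x z i a y] w[of z] ne assms by simp
    then show False using assms(4) by simp
  qed
  ultimately show ?thesis using assms(3) u by auto
qed

text \<open>The points of the support outside \<open>P\<close> contribute at least 2 each to the
  degree sum \<open>3 * m\<close>.\<close>

lemma sum_deg_ge: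
  assumes "P \<subseteq> supp"
  shows "(\<Sum>x\<in>P. deg x) + 2 * (card supp - card P) \<le> 3 * m"
proof -
  have "finite P" using assms finite_subset finite_supp by blast
  then have "(\<Sum>x\<in>supp - P. 2) = 2 * (card supp - card P)"
    using assms by (simp add: card_Diff_subset)
  moreover have "(\<Sum>x\<in>supp - P. 2) \<le> (\<Sum>x\<in>supp - P. deg x)"
    by (rule sum_mono) (use deg_ge_2 in auto)
  moreover have "(\<Sum>x\<in>supp. deg x) = (\<Sum>x\<in>supp - P. deg x) + (\<Sum>x\<in>P. deg x)"
    by (rule sum.subset_diff) (use assms in auto)
  ultimately show ?thesis using sum_deg by simp
qed

lemma card_supp_gt:
  assumes "x \<in> supp"
  shows "card (nb x) < card supp"
proof (rule psubset_card_mono)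
  show "nb x \<subset> supp" using assms nb_supp not_in_nb[of x] by blast
qed simp

text \<open>
  Two adjacent points of degree 2 share their three other neighbours, and all pairs of these three
  have weight at least 2. This forces degrees at least 5 and more than 7 points, so the degree sum
  is at least 25.
\<close>

lemma deg2_independent:
  assumes "m \<le> 7" "x \<in> V" "deg x = 2" "deg y = 2" "y \<in> nb x"
  shows False
proof -
  define P where "P = nb x - {y}"
  have yV: "y \<in> V" using assms(5) by (simp add: nb_def)
  have xy: "x \<noteq> y" using assms(5) by auto
  have xny: "x \<in> nb y" using nb_commute assms by blast
  have w: "card (nb u) = 4" if "u \<in> {x, y}" for u
    using card_nb_eq[of u] wt_le_1[of u] that assms yV by auto
  have cP: "card P = 3" using w[of x] assms(5) by (simp add: P_def)
  have cP': "card (nb y - {x}) = 3" using w[of y] xny by simp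
  have PP: "P = nb y - {x}"
  proof (rule card_subset_eq)
    show "P \<subseteq> nb y - {x}"
    proof
      fix z assume z: "z \<in> P"
      then obtain i where "i < 3" "z \<in> thirds i x y"
        using deg2_clique[of x y z] assms by (auto simp: P_def)
      then show "z \<in> nb y - {x}" using thirds_nb(2)[of z i x y] xy by (auto simp: thirds_def)
    qed
  qed (simp_all add: cP cP')
  \<comment> \<open>The collection containing the block \<open>{x, y, z}\<close> must match
    \<open>a\<close> with \<open>b\<close> both at \<open>x\<close> and at \<open>y\<close>, so
    \<open>x\<close> and \<open>y\<close> are both third points of \<open>a\<close> and
    \<open>b\<close> in it.\<close>
  have heavy: "2 \<le> wt a b" if abz: "P = {a, b, z}" "distinct [a, b, z]" for a b z
  proof -
    have "z \<in> nb x" "y \<noteq> z" using abz(1) by (auto simp: P_def)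
    then obtain i where i: "i < 3" "z \<in> thirds i x y"
      using deg2_clique[of x y z] assms by auto
    have ne: "a \<noteq> x" "b \<noteq> x" "a \<noteq> y" "b \<noteq> y" "z \<noteq> x" "z \<noteq> y"
      using abz PP not_in_nb[of x] not_in_nb[of y] unfolding P_def by blast+
    have nx: "nb x = {y, z, a, b}" using abz assms(5) unfolding P_def by blast
    have ny: "nb y = {x, z, a, b}" using abz(1) PP xny by blast
    have "b \<in> thirds i x a" using deg2_opposite[OF _ _ nx _ i] assms abz(2) ne by auto
    moreover have "b \<in> thirds i y a"
      using deg2_opposite[OF yV assms(4) ny _ i(1)] i(2) abz(2) ne xy thirds_commute by auto
    ultimately have "{x, y} \<subseteq> thirds i a b"
      using ne by (auto simp: thirds_def insert_commute)
    moreover have "a \<noteq> b" using abz by auto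
    ultimately show ?thesis
      using card_mono[of "thirds i a b" "{x, y}"] card_thirds[of a b i] i xy by simp
  qed
  have PV: "P \<subseteq> supp" using nb_supp by (auto simp: P_def)
  \<comment> \<open>Weight 2 gives at least seven neighbours; two of them, \<open>b\<close> and
    \<open>c\<close>, have weight at least 2, so \<open>2 * deg a\<close> is at least 9.\<close>
  have nbge: "7 \<le> card (nb a)" "5 \<le> deg a" if "a \<in> P" for a
  proof -
    have "card (P - {a}) = 2" using cP that by simp
    then obtain b c where bc: "P - {a} = {b, c}" "b \<noteq> c" by (auto simp: card_2_iff)
    then have "2 \<le> wt a b" "2 \<le> wt a c"
      using heavy[of a b c] heavy[of a c b] that by auto
    moreover have "b \<in> supp" "c \<in> supp" "a \<in> V" using PV bc that supp_V by auto
    ultimately have *: "b \<in> nb a" "c \<in> nb a" using bc supp_V by (auto simp: nb_def)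
    show "7 \<le> card (nb a)" using wt_less_card_nb[OF *(1)] \<open>2 \<le> wt a b\<close> by simp
    moreover have "card (nb a) + card {b, c} \<le> 2 * deg a"
      by (rule deg_heavy) (use * \<open>2 \<le> wt a b\<close> \<open>2 \<le> wt a c\<close> \<open>a \<in> V\<close> in auto)
    ultimately show "5 \<le> deg a" using bc(2) by simp
  qed
  obtain a where "a \<in> P" using cP by fastforce
  then have "7 < card supp" using nbge(1)[of a] card_supp_gt[of a] PV by fastforce
  moreover have "(\<Sum>a\<in>P. 5) \<le> (\<Sum>a\<in>P. deg a)" by (rule sum_mono) (use nbge in auto)
  ultimately show False using sum_deg_ge[OF PV] cP assms(1) by simp
qed

text \<open>
  A pair of weight at least 2 forces two points of degree at least 4 and at least six further
  points; the degree sum is at most 21, so one of them has degree 2. Two of its neighbours among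
  the others then have degree at least 3, which makes the sum too large.
\<close>

lemma wt_eq_1:
  assumes "m \<le> 7" "x \<in> V" "y \<in> nb x"
  shows "wt x y = 1"
proof (rule ccontr)
  assume "wt x y \<noteq> 1"
  then have w: "2 \<le> wt x y" using assms(3) by (simp add: nb_def)
  have y: "y \<in> supp" using assms nb_supp by blast
  have x: "x \<in> supp" using nb_supp nb_commute assms by blast
  have xy: "x \<noteq> y" using assms(3) by auto
  have "7 \<le> card (nb x)" using wt_less_card_nb[OF assms(3)] w by simp
  then have c: "8 \<le> card supp" using card_supp_gt[OF x] by simp
  have "4 \<le> deg x"
    using deg_heavy[of x "{y}"] assms w \<open>7 \<le> card (nb x)\<close> by simp
  moreover have "4 \<le> deg y"
  proof -
    have "x \<in> nb y" "2 \<le> wt y x" using nb_commute assms w by (auto simp: wt_commute)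
    moreover then have "7 \<le> card (nb y)" using wt_less_card_nb[of x y] by simp
    ultimately show ?thesis using deg_heavy[of y "{x}"] supp_V[OF y] by simp
  qed
  ultimately have dxy: "8 \<le> deg x + deg y" by simp
  \<comment> \<open>Otherwise the degree sum is at least 8 + 3 * 6 = 26, more than 21.\<close>
  have "\<exists>z \<in> supp - {x, y}. deg z = 2"
  proof (rule ccontr)
    assume *: "\<not> ?thesis"
    have "3 \<le> deg z" if "z \<in> supp - {x, y}" for z
    proof -
      have "deg z \<noteq> 2" "2 \<le> deg z" using that * deg_ge_2[of z] by blast+
      then show ?thesis by linarith
    qed
    then have "(\<Sum>z\<in>supp - {x, y}. 3) \<le> (\<Sum>z\<in>supp - {x, y}. deg z)" by (intro sum_mono) auto
    moreover have "card (supp - {x, y}) \<ge> 6" using c x y xy by (simp add: card_Diff_subset)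
    moreover have "(\<Sum>z\<in>supp. deg z) = (\<Sum>z\<in>supp - {x, y}. deg z) + (\<Sum>z\<in>{x, y}. deg z)"
      by (rule sum.subset_diff) (use x y in auto)
    ultimately show False using sum_deg assms(1) dxy xy by simp
  qed
  then obtain z where z: "z \<in> supp" "z \<noteq> x" "z \<noteq> y" "deg z = 2" by blast
  \<comment> \<open>\<open>Q\<close> consists of two of the at least four neighbours of
    \<open>z\<close>; being adjacent to a point of degree 2, they have degree at least 3.\<close>
  have "2 \<le> card (nb z - {x, y})"
    using card_nb_ge[OF z(1)] diff_card_le_card_Diff[of "{x, y}" "nb z"] xy by simp
  then obtain Q where Q: "Q \<subseteq> nb z - {x, y}" "card Q = 2"
    by (rule obtain_subset_with_card_n)
  have "3 \<le> deg u" if "u \<in> nb z" for u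
  proof -
    have "deg u \<noteq> 2" using deg2_independent[OF assms(1) supp_V[OF z(1)] z(4) _ that] by blast
    then show ?thesis using deg_ge_2[OF nb_supp[OF that]] by linarith
  qed
  then have "(\<Sum>u\<in>Q. 3) \<le> (\<Sum>u\<in>Q. deg u)" by (intro sum_mono) (use Q in auto)
  then have Q6: "6 \<le> (\<Sum>u\<in>Q. deg u)" using Q(2) by simp
  have fQ: "finite Q" using Q(1) finite_subset finite_nb by blast
  have nQ: "x \<notin> Q" "y \<notin> insert x Q" using Q xy by auto
  have "insert y (insert x Q) \<subseteq> supp" using Q nb_supp x y by auto
  \<comment> \<open>The left side is at least 8 + 6 + 2 * 4 = 22, more than 21.\<close>
  from sum_deg_ge[OF this] have "deg y + (deg x + (\<Sum>u\<in>Q. deg u)) + 2 * (card supp - 4) \<le> 3 * m"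
    unfolding sum.insert[OF finite.insertI[OF fQ] nQ(2)] sum.insert[OF fQ nQ(1)]
      card_insert_disjoint[OF finite.insertI[OF fQ] nQ(2)] card_insert_disjoint[OF fQ nQ(1)] Q(2)
    by simp
  then show False using c assms(1) dxy Q6 by linarith
qed

section \<open>Degrees compared with the volume\<close>

lemma block_third:
  assumes "B \<in> T i" "i < 3" "x \<in> B" "y \<in> B" "x \<noteq> y"
  obtains z where "z \<in> thirds i x y" "B = {x, y, z}"
proof -
  have "card (B - {x, y}) = 1" using block(2)[OF assms(1,2)] assms by (simp add: card_Diff_subset)
  then obtain z where "B - {x, y} = {z}" by (auto simp: card_1_singleton_iff)
  then have "B = {x, y, z}" "z \<noteq> x" "z \<noteq> y" using assms by auto
  then show ?thesis using assms that by (auto simp: thirds_def)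
qed

text \<open>Removing \<open>x\<close> from a block of \<open>T 1\<close> leaves a pair that also
  lies in a block of \<open>T 0\<close>; that block avoids \<open>x\<close> because the collections
  are disjoint. The choice is injective, so \<open>deg x\<close> is at most
  \<open>m - deg x\<close>.\<close>

lemma two_deg_le:
  assumes "m \<le> 7" "x \<in> V"
  shows "2 * deg x \<le> m"
proof -
  let ?D = "{B \<in> T 1. x \<in> B}" and ?E = "{B \<in> T 0. x \<notin> B}"
  have "\<exists>t \<in> ?E. B - {x} \<subseteq> t" if B: "B \<in> ?D" for B
  proof -
    have "card (B - {x}) = 2" using B block(2)[of B 1] by simp
    then obtain p q where pq: "B - {x} = {p, q}" "p \<noteq> q" by (auto simp: card_2_iff)
    then have Beq: "B = {p, q, x}" "x \<noteq> p" "x \<noteq> q" using B by auto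
    then have "x \<in> thirds 1 p q" using B by (auto simp: thirds_def)
    then have "0 < card (thirds 1 p q)" by (auto simp: card_gt_0_iff)
    then have "0 < card (thirds 0 p q)" using card_thirds[OF pq(2)] by simp
    then obtain z where z: "z \<in> thirds 0 p q" by (metis card.empty ex_in_conv less_irrefl)
    moreover have "z \<noteq> x"
      using thirds_disjoint[of 0 1 p q] z \<open>x \<in> thirds 1 p q\<close> by auto
    ultimately have "{p, q, z} \<in> T 0" "x \<notin> {p, q, z}"
      using Beq by (simp_all add: thirds_def)
    then show ?thesis unfolding pq(1) by blast
  qed
  then obtain f where f: "\<And>B. B \<in> ?D \<Longrightarrow> f B \<in> ?E \<and> B - {x} \<subseteq> f B" by metis
  \<comment> \<open>Two pairs inside the 3-set \<open>f B\<close> share a point \<open>p\<close>,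
    and the pair of \<open>x\<close> and \<open>p\<close>, having weight 1, lies in only one block
    of \<open>T 1\<close>.\<close>
  have "inj_on f ?D"
  proof (rule inj_onI)
    fix B B' assume B: "B \<in> ?D" "B' \<in> ?D" "f B = f B'"
    have c: "card (B - {x}) = 2" "card (B' - {x}) = 2" "card (f B) = 3"
      using B f[of B] block(2)[of _ 1] block(2)[of "f B" 0] by auto
    have "(B - {x}) \<inter> (B' - {x}) \<noteq> {}"
    proof
      assume "(B - {x}) \<inter> (B' - {x}) = {}"
      moreover have "finite (B - {x})" "finite (B' - {x})" "finite (f B)"
        by (rule card_ge_0_finite, use c in linarith)+
      ultimately have "4 = card ((B - {x}) \<union> (B' - {x}))" using c by (simp add: card_Un_disjoint)
      also have "\<dots> \<le> card (f B)"
        by (rule card_mono) (use \<open>finite (f B)\<close> f[of B] f[of B'] B in auto)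
      finally show False using c by simp
    qed
    then obtain p where p: "p \<in> B" "p \<in> B'" "p \<noteq> x" by blast
    have BT: "B \<in> T 1" "x \<in> B" "B' \<in> T 1" "x \<in> B'" using B by auto
    obtain q where q: "q \<in> thirds 1 x p" "B = {x, p, q}"
      using block_third[of B 1 x p] BT p by auto
    obtain q' where q': "q' \<in> thirds 1 x p" "B' = {x, p, q'}"
      using block_third[of B' 1 x p] BT p by auto
    have "p \<in> nb x" using thirds_nb(3)[OF q(1)] p by auto
    then have "q = q'" using thirds_unique[OF wt_eq_1[OF assms], of p 1 q q'] p q q' by auto
    then show "B = B'" using q q' by simp
  qed
  then have "card ?D \<le> card ?E"
    by (rule card_inj_on_le) (use f finite_T in auto)
  moreover have "card ?E = m - deg x" "deg x \<le> m"
  proof -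
    have "?E = T 0 - {B \<in> T 0. x \<in> B}" by auto
    then show "card ?E = m - deg x"
      using card_T[of 0] by (simp add: card_Diff_subset finite_T deg_def)
    show "deg x \<le> m" unfolding deg_def
      using card_mono[of "T 0" "{B \<in> T 0. x \<in> B}"] card_T[of 0] finite_T[of 0] by simp
  qed
  ultimately show ?thesis using deg_eq[OF assms(2), of 1] by simp
qed

text \<open>Of two adjacent points one has degree at least 3, and the volume is at least twice
  that.\<close>

lemma volume_ge_6:
  assumes "m \<le> 7" "0 < m"
  shows "6 \<le> m"
proof -
  have "supp \<noteq> {}" using sum_deg assms(2) by auto
  then obtain x where x: "x \<in> supp" by auto
  obtain y where y: "y \<in> nb x" using nb_nonempty[OF x] by auto
  have "y \<in> supp" using nb_supp y by auto
  moreover have "deg x \<noteq> 2 \<or> deg y \<noteq> 2"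
    using deg2_independent[OF assms(1) supp_V[OF x] _ _ y] by blast
  ultimately have "3 \<le> deg x \<or> 3 \<le> deg y" using deg_ge_2[OF x] deg_ge_2[of y] by linarith
  moreover have "2 * deg x \<le> m" "2 * deg y \<le> m"
    using two_deg_le[OF assms(1)] supp_V x \<open>y \<in> supp\<close> by blast+
  ultimately show ?thesis by linarith
qed

section \<open>Excluding volume 7\<close>

lemma volume_7_deg:
  assumes "m = 7" "x \<in> supp"
  shows "deg x = 2 \<or> deg x = 3"
  using two_deg_le[of x] deg_ge_2[of x] supp_V[of x] assms by fastforce

lemma volume_7_card_nb:
  assumes "m = 7" "x \<in> supp"
  shows "card (nb x) = 2 * deg x"
  using card_nb_eq[of x] wt_eq_1[of x] assms supp_V by simp

text \<open>Suppose \<open>x\<close> has degree 2. Then five points have degree 3 and three have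
  degree 2. Each point of \<open>S\<close> has one non-neighbour and each point of \<open>R\<close>
  misses one point of \<open>S\<close>. The four neighbours of \<open>x\<close> would have to be
  missed by different points of \<open>R\<close> other than \<open>x\<close>, of which there are
  two.\<close>

lemma volume_7_deg_3:
  assumes m: "m = 7" and "x \<in> supp"
  shows "deg x = 3"
proof (rule ccontr)
  assume "deg x \<noteq> 3"
  then have x2: "deg x = 2" using volume_7_deg assms by blast
  define S where "S = {y \<in> supp. deg y = 3}"
  define R where "R = {y \<in> supp. deg y = 2}"
  have fin: "finite S" "finite R" by (simp_all add: S_def R_def)
  have SR: "supp = S \<union> R" "S \<inter> R = {}" using volume_7_deg[OF m] by (auto simp: S_def R_def)
  have "(\<Sum>y\<in>supp. deg y) = (\<Sum>y\<in>S. deg y) + (\<Sum>y\<in>R. deg y)"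
    unfolding SR(1) by (rule sum.union_disjoint) (use SR fin in auto)
  also have "\<dots> = 3 * card S + 2 * card R" by (simp add: S_def R_def)
  finally have sum: "3 * card S + 2 * card R = 21" using sum_deg m by simp
  have nbR: "nb y \<subseteq> S" if "y \<in> R" for y
  proof
    fix z assume z: "z \<in> nb y"
    then have "deg z \<noteq> 2" using deg2_independent[of y z] that m supp_V by (auto simp: R_def)
    then show "z \<in> S" using volume_7_deg[OF m nb_supp[OF z]] nb_supp[OF z] by (auto simp: S_def)
  qed
  have xR: "x \<in> R" using assms x2 by (simp add: R_def)
  have nb4: "card (nb y) = 4" if "y \<in> R" for y
    using volume_7_card_nb[OF m] that by (simp add: R_def)
  have "4 \<le> card S" using card_mono[OF fin(1) nbR[OF xR]] nb4[OF xR] by simp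
  moreover have "0 < card R" using xR fin by (auto simp: card_gt_0_iff)
  \<comment> \<open>By the equation \<open>card S\<close> is odd; it is at least 4, and below 7
    because \<open>R\<close> is nonempty.\<close>
  ultimately have cS: "card S = 5" and cR: "card R = 3" using sum by presburger+
  define nonnb where "nonnb y = supp - {y} - nb y" for y
  have nonnb: "card (nonnb y) = 1" if "y \<in> S" for y
  proof -
    have "y \<in> supp" "card (nb y) = 6" using that volume_7_card_nb[OF m] by (auto simp: S_def)
    moreover have "nb y \<subseteq> supp - {y}" using nb_supp by auto
    moreover have "card supp = 8" unfolding SR(1) using SR fin cS cR by (simp add: card_Un_disjoint)
    ultimately show ?thesis by (simp add: nonnb_def card_Diff_subset)
  qed
  have nonnbR: "card (S - nb y) = 1" if "y \<in> R" for y
    using nbR[OF that] nb4[OF that] cS by (simp add: card_Diff_subset)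
  have sym: "z \<in> nb y \<longleftrightarrow> y \<in> nb z" if "y \<in> supp" "z \<in> supp" for y z
    using nb_commute that supp_V by blast
  obtain q where q: "S - nb x = {q}" using nonnbR[OF xR] by (auto simp: card_1_singleton_iff)
  have qx: "nonnb q = {x}"
  proof -
    have "q \<in> S" "q \<notin> nb x" using q by blast+
    moreover then have "x \<notin> nb q" "x \<noteq> q" using sym[of q x] assms(2) x2 by (auto simp: S_def)
    ultimately have "x \<in> nonnb q" "card (nonnb q) = 1"
      using assms(2) nonnb by (simp_all add: nonnb_def)
    then show ?thesis by (metis card_1_singletonE singletonD)
  qed
  \<comment> \<open>The non-neighbour \<open>z\<close> of \<open>y\<close> is not \<open>q\<close>,
    which misses only \<open>x\<close>, and not a neighbour of \<open>x\<close>, since these are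
    pairwise adjacent. As \<open>S\<close> consists of \<open>q\<close> and the neighbours of
    \<open>x\<close>, \<open>z\<close> lies in \<open>R\<close>.\<close>
  have ex: "\<exists>z. z \<in> R - {x} \<and> y \<in> S - nb z" if y: "y \<in> nb x" for y
  proof -
    have yS: "y \<in> S" using nbR xR y by blast
    obtain z where z: "nonnb y = {z}" using nonnb[OF yS] by (auto simp: card_1_singleton_iff)
    then have zz: "z \<in> supp" "z \<noteq> y" "z \<notin> nb y" by (auto simp: nonnb_def)
    have ys: "y \<in> supp" using yS by (simp add: S_def)
    have "z \<noteq> x" using sym[OF assms(2) ys] y zz by auto
    moreover have "z \<notin> nb x"
    proof
      assume "z \<in> nb x"
      then obtain i where "i < 3" "z \<in> thirds i x y"
        using deg2_clique[OF supp_V[OF assms(2)] x2 y] zz by auto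
      moreover have "x \<noteq> y" using y by auto
      ultimately show False using zz thirds_nb(2) by blast
    qed
    moreover have "z \<noteq> q"
    proof
      assume "z = q"
      then have "y \<in> nonnb q" using zz ys sym[of y q] by (auto simp: nonnb_def)
      then show False using qx y by auto
    qed
    ultimately have "z \<in> R - {x}" using zz q SR by auto
    moreover have "y \<in> S - nb z" using yS sym[of y z] zz ys by auto
    ultimately show ?thesis by blast
  qed
  then obtain f where f: "\<And>y. y \<in> nb x \<Longrightarrow> f y \<in> R - {x} \<and> y \<in> S - nb (f y)" by metis
  have "inj_on f (nb x)"
  proof (rule inj_onI)
    fix y z assume yz: "y \<in> nb x" "z \<in> nb x" "f y = f z"
    then have "card (S - nb (f y)) = 1" using nonnbR f by blast
    moreover have "y \<in> S - nb (f y)" "z \<in> S - nb (f y)" using f[OF yz(1)] f[OF yz(2)] yz(3) by auto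
    ultimately show "y = z" by (metis card_1_singletonE singletonD)
  qed
  then have "card (nb x) \<le> card (R - {x})"
    by (rule card_inj_on_le) (use f fin in auto)
  then show False using nb4[OF xR] cR xR by simp
qed

lemma third_exists:
  assumes "0 < wt x y" "x \<noteq> y" "i < 3"
  obtains z where "z \<in> supp" "z \<noteq> x" "z \<noteq> y" "{x, y, z} \<in> T i"
proof -
  have "thirds i x y \<noteq> {}" using card_thirds[OF assms(2,3)] assms(1) by auto
  then obtain z where z: "z \<in> thirds i x y" by blast
  then have "z \<in> supp" using thirds_nb(1)[OF z assms(2,3)] nb_supp by blast
  then show ?thesis using z that by (auto simp: thirds_def)
qed

text \<open>With all degrees 3 there are seven points and all pairs have weight 1, so each
  collection is a Fano plane. The points are labelled so that \<open>T 0\<close> becomes the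
  standard plane.\<close>

lemma volume_not_7: "m \<noteq> 7"
proof
  assume m: "m = 7"
  have "3 * card supp = 21" using sum_deg volume_7_deg_3[OF m] m by simp
  then have c7: "card supp = 7" by simp
  have nb_all: "nb x = supp - {x}" if "x \<in> supp" for x
  proof (rule card_subset_eq)
    show "nb x \<subseteq> supp - {x}" using nb_supp by auto
    show "card (nb x) = card (supp - {x})"
      using that c7 volume_7_card_nb[OF m] volume_7_deg_3[OF m] by simp
  qed simp
  have w1: "wt x y = 1" if "x \<in> supp" "y \<in> supp" "x \<noteq> y" for x y
    using wt_eq_1[of x y] nb_all[OF that(1)] that m supp_V by auto
  have third: "\<exists>z \<in> supp - {x, y}. {x, y, z} \<in> T i"
    if "x \<in> supp" "y \<in> supp" "x \<noteq> y" "i < 3" for x y i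
    using third_exists[of x y i] w1[of x y] that by (metis DiffI insertE singletonD zero_less_one)
  have uniq: "z = w"
    if "{x, y, z} \<in> T i" "{x, y, w} \<in> T i" "x \<in> supp" "y \<in> supp" "x \<noteq> y"
      "z \<notin> {x, y}" "w \<notin> {x, y}" "i < 3" for x y z w i
    by (rule thirds_unique[of x y i]) (use that w1 in \<open>auto simp: thirds_def\<close>)
  have uniq0: "z = w"
    if "{x, y, z} \<in> T 0" "{x, y, w} \<in> T 0" "distinct [x, y, z]" "distinct [x, y, w]"
      "x \<in> supp" "y \<in> supp" for x y z w
    using uniq[of x y z 0 w] that by auto
  have third0: "\<exists>z \<in> supp. z \<noteq> x \<and> z \<noteq> y \<and> {x, y, z} \<in> T 0"
    if "x \<in> supp" "y \<in> supp" "x \<noteq> y" for x y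
    using third[of x y 0] that by auto
  have new: "\<exists>z \<in> supp. z \<notin> set xs" if "length xs < 7" for xs
  proof (rule ccontr)
    assume "\<not> ?thesis"
    then have "card supp \<le> card (set xs)" by (intro card_mono) auto
    then show False using c7 card_length[of xs] that by simp
  qed
  obtain x where x: "x \<in> supp" using new[of "[]"] by auto
  obtain y where y: "y \<in> supp" "y \<noteq> x" using new[of "[x]"] by auto
  obtain z where z: "z \<in> supp" "z \<noteq> x" "z \<noteq> y" "{x, y, z} \<in> T 0"
    using third0[of x y] x y by auto
  obtain s where s: "s \<in> supp" "s \<noteq> x" "s \<noteq> y" "s \<noteq> z" using new[of "[x, y, z]"] by auto
  obtain t where t: "t \<in> supp" "t \<noteq> x" "t \<noteq> s" "{x, s, t} \<in> T 0"
    using third0[of x s] x s by auto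
  have t': "t \<noteq> y" "t \<noteq> z"
    using uniq0[of x y s z] uniq0[of x z s y] x y z s t by (auto simp: insert_commute)
  obtain u0 where u0: "u0 \<in> supp" "u0 \<noteq> x" "u0 \<noteq> y" "u0 \<noteq> z" "u0 \<noteq> s" "u0 \<noteq> t"
    using new[of "[x, y, z, s, t]"] by auto
  obtain v0 where v0: "v0 \<in> supp" "v0 \<noteq> x" "v0 \<noteq> u0" "{x, u0, v0} \<in> T 0"
    using third0[of x u0] x u0 by auto
  have v0': "v0 \<noteq> y" "v0 \<noteq> z" "v0 \<noteq> s" "v0 \<noteq> t"
    using uniq0[of x y u0 z] uniq0[of x z u0 y] uniq0[of x s u0 t] uniq0[of x t u0 s]
      x y z s t u0 v0 by (auto simp: insert_commute)
  have S0: "supp = {x, y, z, s, t, u0, v0}"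
    by (rule card_subset_eq[symmetric]) (use x y z s t t' u0 v0 v0' c7 in auto)
  obtain u where u: "u \<in> supp" "u \<noteq> y" "u \<noteq> s" "{y, s, u} \<in> T 0"
    using third0[of y s] y s by auto
  have u': "u \<noteq> x" "u \<noteq> z" "u \<noteq> t"
    using uniq0[of x y s z] uniq0[of y z s x] uniq0[of s t y x] x y z s t t' u
    by (auto simp: insert_commute)
  have uu: "u = u0 \<or> u = v0" using S0 u u' by auto
  \<comment> \<open>The third point of \<open>y\<close> and \<open>s\<close> is one of the two
    points \<open>u0\<close>, \<open>v0\<close> on the last line through \<open>x\<close>; it is
    called \<open>u\<close>, the other \<open>v\<close>.\<close>
  define v where "v = (if u = u0 then v0 else u0)"
  have vv: "v \<in> supp" "v \<noteq> x" "v \<noteq> y" "v \<noteq> z" "v \<noteq> s" "v \<noteq> t" "v \<noteq> u"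
    using uu u0 v0 v0' by (simp_all add: v_def)
  have xuv: "{x, u, v} \<in> T 0"
    using uu v0 by (auto simp: v_def insert_commute)
  have S: "supp = {x, y, z, s, t, u, v}"
    by (rule card_subset_eq[symmetric]) (use x y z s t t' u u' vv c7 in auto)
  \<comment> \<open>The remaining lines are forced: any other choice of third point gives some pair
    two third points.\<close>
  have ytv: "{y, t, v} \<in> T 0"
  proof -
    obtain w where w: "w \<in> supp" "w \<noteq> y" "w \<noteq> t" "{y, t, w} \<in> T 0"
      using third0[of y t] y t t' by auto
    have "w \<noteq> x" "w \<noteq> z" "w \<noteq> s" "w \<noteq> u"
      using uniq0[of x y t z] uniq0[of y z t x] uniq0[of s t y x] uniq0[of y u t s]
        x y z s t t' u u' w by (auto simp: insert_commute)
    then have "w = v" using w(1) S w(2,3) by blast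
    then show ?thesis using w by simp
  qed
  have zsv: "{z, s, v} \<in> T 0"
  proof -
    obtain w where w: "w \<in> supp" "w \<noteq> z" "w \<noteq> s" "{z, s, w} \<in> T 0"
      using third0[of z s] z s by auto
    have "w \<noteq> x" "w \<noteq> y" "w \<noteq> t" "w \<noteq> u"
      using uniq0[of x z s y] uniq0[of y z s x] uniq0[of s t z x] uniq0[of s u z y]
        x y z s t t' u u' w by (auto simp: insert_commute)
    then have "w = v" using w(1) S w(2,3) by blast
    then show ?thesis using w by simp
  qed
  have ztu: "{z, t, u} \<in> T 0"
  proof -
    obtain w where w: "w \<in> supp" "w \<noteq> z" "w \<noteq> t" "{z, t, w} \<in> T 0"
      using third0[of z t] z t t' by auto
    have "w \<noteq> x" "w \<noteq> y" "w \<noteq> s" "w \<noteq> v"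
      using uniq0[of x z t y] uniq0[of y z t x] uniq0[of s t z x] uniq0[of t v z y]
        x y z s t t' u u' vv ytv w by (auto simp: insert_commute)
    then have "w = u" using w(1) S w(2,3) by blast
    then show ?thesis using w by simp
  qed
  define ps where "ps = [x, y, z, s, t, u, v]"
  define p where "p n = ps ! n" for n
  have "distinct ps" using y z s t t' u u' vv by (auto simp: ps_def)
  then have inj: "p i = p j \<longleftrightarrow> i = j" if "i < 7" "j < 7" for i j
    using that by (simp add: p_def nth_eq_iff_index_eq ps_def)
  have len: "length ps = 7" by (simp add: ps_def)
  have sp: "set ps = supp" using S by (simp add: ps_def)
  have ps: "p i \<in> supp" if "i < 7" for i
    using that sp nth_mem[of i ps] by (simp add: p_def ps_def)
  have surj: "\<exists>i<7. w = p i" if "w \<in> supp" for w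
    using that in_set_conv_nth[of w ps] unfolding sp p_def by (auto simp: len)
  \<comment> \<open>The collections pulled back along the labelling \<open>p\<close>;
    \<open>fano_plane\<close> inspects only labels below 7, where \<open>p\<close> is
    injective.\<close>
  define X where "X i = {B. p ` B \<in> T i}" for i
  have "fano_plane (X i)" if i: "i < 3" for i
    unfolding fano_plane_def
  proof (intro allI impI conjI)
    fix a b :: nat assume ab: "b < 7" "a < b"
    then have ne: "p a \<noteq> p b" using inj by simp
    show "\<exists>c<7. c \<noteq> a \<and> c \<noteq> b \<and> {a, b, c} \<in> X i"
    proof -
      obtain w where w: "w \<in> supp - {p a, p b}" "{p a, p b, w} \<in> T i"
        using third[OF ps[of a] ps[of b] ne i] ab by auto
      then obtain c where "c < 7" "w = p c" using surj by blast
      then show ?thesis using w by (auto simp: X_def)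
    qed
    fix c d :: nat
    assume cd: "d < 7" "c < d" "c \<noteq> a" "c \<noteq> b" "d \<noteq> a" "d \<noteq> b" and c: "{a, b, c} \<in> X i"
    show "{a, b, d} \<notin> X i"
    proof
      assume "{a, b, d} \<in> X i"
      then have "p c = p d"
        using uniq[of "p a" "p b" "p c" i "p d"] c ab cd ne ps inj that by (simp add: X_def)
      then show False using inj cd by simp
    qed
  qed
  moreover have "X i \<inter> X j = {}" if "i < 3" "j < 3" "i \<noteq> j" for i j
    using disjoint_T that by (auto simp: X_def)
  moreover have "{{0, 1, 2}, {0, 3, 4}, {0, 5, 6}, {1, 3, 5}, {1, 4, 6}, {2, 3, 6}, {2, 4, 5}} \<subseteq> X 0"
    using z t u xuv ytv zsv ztu by (simp add: X_def p_def ps_def)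
  \<comment> \<open>The plane \<open>X 0\<close> enters as the set \<open>A\<close>, through its
    seven lines.\<close>
  ultimately show False
    using no_three_disjoint_fano_planes[of "X 1" "X 2" "X 0"] by simp
qed

end

subsection \<open>The set of volumes\<close>

text \<open>The trades were found with a SAT solver.\<close>

lemma small_trade_volumes: "{6, 8, 9, 10, 11, 13} \<subseteq> trade_volumes 3 2 3"
proof -
  have t6: "is_listed_trade 7
      [(0, 1, 2), (0, 3, 6), (0, 4, 5), (1, 3, 4), (2, 3, 5), (2, 4, 6)]
      [(0, 1, 3), (0, 2, 5), (0, 4, 6), (1, 2, 4), (2, 3, 6), (3, 4, 5)]
      [(0, 1, 4), (0, 2, 6), (0, 3, 5), (1, 2, 3), (2, 4, 5), (3, 4, 6)]"
    by code_simp
  have t8: "is_listed_trade 8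
      [(0, 1, 2), (0, 3, 6), (0, 4, 7), (1, 3, 5), (1, 4, 6), (2, 3, 7), (2, 4, 5),
       (5, 6, 7)]
      [(0, 1, 3), (0, 2, 7), (0, 4, 6), (1, 2, 4), (1, 5, 6), (2, 3, 5), (3, 6, 7),
       (4, 5, 7)]
      [(0, 1, 4), (0, 2, 3), (0, 6, 7), (1, 2, 5), (1, 3, 6), (2, 4, 7), (3, 5, 7),
       (4, 5, 6)]"
    by code_simp
  have t9: "is_listed_trade 9
      [(0, 1, 2), (0, 3, 7), (0, 4, 8), (0, 5, 6), (1, 3, 8), (1, 4, 6), (1, 5, 7),
       (2, 5, 8), (6, 7, 8)]
      [(0, 1, 3), (0, 2, 8), (0, 4, 6), (0, 5, 7), (1, 2, 5), (1, 4, 8), (1, 6, 7),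
       (3, 7, 8), (5, 6, 8)]
      [(0, 1, 4), (0, 2, 5), (0, 3, 8), (0, 6, 7), (1, 2, 8), (1, 3, 7), (1, 5, 6),
       (4, 6, 8), (5, 7, 8)]"
    by code_simp
  have t10: "is_listed_trade 9
      [(0, 1, 2), (0, 3, 8), (0, 4, 7), (0, 5, 6), (1, 3, 6), (1, 4, 8), (2, 4, 6),
       (2, 5, 8), (3, 5, 7), (6, 7, 8)]
      [(0, 1, 3), (0, 2, 8), (0, 4, 6), (0, 5, 7), (1, 2, 4), (1, 6, 8), (2, 5, 6),
       (3, 5, 8), (3, 6, 7), (4, 7, 8)]
      [(0, 1, 4), (0, 2, 5), (0, 3, 7), (0, 6, 8), (1, 2, 6), (1, 3, 8), (2, 4, 8),
       (3, 5, 6), (4, 6, 7), (5, 7, 8)]"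
    by code_simp
  have t11: "is_listed_trade 9
      [(0, 1, 2), (0, 3, 7), (0, 4, 6), (0, 5, 8), (1, 3, 5), (1, 4, 7), (1, 6, 8),
       (2, 3, 6), (2, 7, 8), (3, 4, 8), (5, 6, 7)]
      [(0, 1, 3), (0, 2, 6), (0, 4, 8), (0, 5, 7), (1, 2, 7), (1, 4, 6), (1, 5, 8),
       (2, 3, 8), (3, 4, 7), (3, 5, 6), (6, 7, 8)]
      [(0, 1, 4), (0, 2, 8), (0, 3, 5), (0, 6, 7), (1, 2, 6), (1, 3, 8), (1, 5, 7),
       (2, 3, 7), (3, 4, 6), (4, 7, 8), (5, 6, 8)]"
    by code_simp
  have t13: "is_listed_trade 10
      [(0, 1, 2), (0, 3, 7), (0, 4, 6), (0, 5, 8), (1, 3, 9), (1, 4, 5), (1, 6, 7),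
       (2, 4, 9), (2, 5, 7), (2, 6, 8), (3, 4, 8), (3, 5, 6), (7, 8, 9)]
      [(0, 1, 3), (0, 2, 4), (0, 5, 6), (0, 7, 8), (1, 2, 6), (1, 4, 9), (1, 5, 7),
       (2, 5, 8), (2, 7, 9), (3, 4, 5), (3, 6, 7), (3, 8, 9), (4, 6, 8)]
      [(0, 1, 4), (0, 2, 7), (0, 3, 5), (0, 6, 8), (1, 2, 5), (1, 3, 6), (1, 7, 9),
       (2, 4, 6), (2, 8, 9), (3, 4, 9), (3, 7, 8), (4, 5, 8), (5, 6, 7)]"
    by code_simp
  show ?thesis
    using t6[THEN listed_trade] t8[THEN listed_trade] t9[THEN listed_trade]
      t10[THEN listed_trade] t11[THEN listed_trade] t13[THEN listed_trade]
    by (simp add: eval_nat_numeral)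
qed

text \<open>Subtracting 6 leads back to an admissible volume, except from 6, 8, 9, 10, 11 and from
  13, where it gives 7; these are the explicit trades.\<close>

lemma trade_volumes_sufficient:
  assumes "6 \<le> n" "n \<noteq> 7"
  shows "n \<in> trade_volumes 3 2 3"
  using assms
proof (induction n rule: less_induct)
  case (less n)
  show ?case
  proof (cases "n \<in> {6, 8, 9, 10, 11, 13}")
    case True
    then show ?thesis using small_trade_volumes by blast
  next
    case False
    then have "6 \<le> n - 6" "n - 6 \<noteq> 7" "n - 6 < n" using less.prems by auto
    then have "n - 6 \<in> trade_volumes 3 2 3" using less.IH by blast
    then have "n - 6 + 6 \<in> trade_volumes 3 2 3"
      by (rule trade_volumes_add) (use small_trade_volumes in blast)
    then show ?thesis using less.prems by simp
  qed
qed

theorem theorem4p2: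
  shows "trade_volumes 3 2 3 = {m. 1 \<le> m} - {1, 2, 3, 4, 5, 7}"
proof (rule set_eqI)
  fix n :: nat
  show "n \<in> trade_volumes 3 2 3 \<longleftrightarrow> n \<in> {m. 1 \<le> m} - {1, 2, 3, 4, 5, 7}"
  proof
    assume "n \<in> trade_volumes 3 2 3"
    then obtain v :: nat and T where n: "0 < n" and "way_trade 3 {..<v} 3 2 n T"
      unfolding trade_volumes_def by blast
    then interpret triple_trade "{..<v}" T n by unfold_locales
    have "6 \<le> n" using volume_ge_6 n by linarith
    then show "n \<in> {m. 1 \<le> m} - {1, 2, 3, 4, 5, 7}" using volume_not_7 by auto
  next
    assume "n \<in> {m. 1 \<le> m} - {1, 2, 3, 4, 5, 7}"
    then have "6 \<le> n" "n \<noteq> 7" by auto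
    then show "n \<in> trade_volumes 3 2 3" by (rule trade_volumes_sufficient)
  qed
qed

end
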